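(* Let $G=(D,S,E)$ be a finite bipartite graph without isolated nodes, let $\lambda: D\to(0,\infty)$ and $\mu: S\to(0,\infty)$ be rate functions, and let $\boldsymbol{X}$ be the load balancing process associated with $G$, $\lambda$ and $\mu$. Fix constants $\lambda_0,\mu_0$ such that $$0<\lambda_0\le \min_{d\in D}\lambda(d),\qquad \max_{u\in S}\mu(u)\le \mu_0<\infty,$$ and let $\rho_0 = \lambda_0/\mu_0$. Suppose that $\boldsymbol{X}$ is ergodic and let $q$ be its steady-state occupancy. Then $$\mathbb{E}[q(i)] \ge \frac{\rho_0}{\beta_G(\beta_G+1)+\rho_0}\,\frac{[r(\rho_0,\beta_G+1)]^i}{\beta_G+1}\quad\text{for all } i\in\mathbb{N} \text{ with } i\ge \frac{1}{\rho_0},$$ where $r(\rho,x) = (\rho/x)^x$ and $$\beta_G = \frac{1}{|D|}\sum_{d\in D}\deg(d).$$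
   Context: Here $\mathbb{N}=\{0,1,2,\dots\}$. Networks. $D$ and $S$ are finite nonempty sets (dispatchers and servers) and $E\subset D\times S$; dispatcher $d$ can send tasks to server $u$ only if $(d,u)\in E$ (then $d$ and $u$ are called compatible). No isolated nodes means each dispatcher is compatible with at least one server and each server with at least one dispatcher. For $d\in D$, $\mathcal{N}(d)=\{u\in S:(d,u)\in E\}$ and $\deg(d)=|\mathcal{N}(d)|$; for $u\in S$, $\mathcal{N}(u)=\{d\in D:(d,u)\in E\}$. Load balancing process. Each dispatcher $d$ receives tasks as an independent Poisson process of intensity $\lambda(d)$ and sends each incoming task immediately to a compatible server with the shortest queue (fewest tasks, including any in service), ties broken uniformly at random. Each server $u$ executes its tasks sequentially, with independent exponentially distributed service times of rate $\mu(u)$. Let $\boldsymbol{X}(t,u)$ be the number of tasks at server $u$ at time $t$. Then $\boldsymbol{X}$ is a continuous-time Markov chain on $\mathbb{N}^S$ and is called the load balancing process associated with $G$, $\lambda$, $\mu$. Equivalently, from state $x\in\mathbb{N}^S$ the transition $x\to x+e_u$ has rate $\sum_{d\in\mathcal{N}(u)}\lambda(d)\,\mathbf{1}\{x(u)=\min_{v\in\mathcal{N}(d)}x(v)\}\,/\,|\{w\in\mathcal{N}(d):x(w)=\min_{v\in\mathcal{N}(d)}x(v)\}|$ and the transition $x\to x-e_u$ has rate $\mu(u)\mathbf{1}\{x(u)>0\}$, where $e_u$ is the unit vector of coordinate $u$. Steady-state occupancy. If $\boldsymbol{X}$ is ergodic (i.e., this irreducible chain is positive recurrent), let $X$ be a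 random vector with its unique stationary distribution. The steady-state occupancy is the random sequence $q(i)=\frac{1}{|S|}\sum_{u\in S}\mathbf{1}\{X(u)\ge i\}$, $i\in\mathbb{N}$. *)

theory Defs
  imports "HOL-Probability.Probability"
begin

section \<open>Continuous-time Markov chains on a discrete state space\<close>

text \<open>
  A chain is given in the usual way by laws \<open>Pr x\<close>, one for every initial state \<open>x\<close>, and
  coordinate maps \<open>X t\<close> for times \<open>t \<ge> 0\<close>; \<open>X t\<close> for negative \<open>t\<close> is irrelevant.
\<close>

definition trans_prob :: "('x \<Rightarrow> 'w measure) \<Rightarrow> (real \<Rightarrow> 'w \<Rightarrow> 'x) \<Rightarrow> real \<Rightarrow> 'x \<Rightarrow> 'x \<Rightarrow> real" where
  "trans_prob Pr X t x y = measure (Pr x) {\<omega> \<in> space (Pr x). X t \<omega> = y}"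

text \<open>
  \<open>Q x y\<close> is the rate of the transition from \<open>x\<close> to \<open>y\<close> for \<open>y \<noteq> x\<close>; the values \<open>Q x x\<close> are not
  used.  The conjuncts say: probability spaces, random variables, initial state \<open>x\<close>,
  right-continuous paths (with respect to the discrete topology), time-homogeneous
  Markov property, and infinitesimal transition and exit rates.
\<close>

definition markov_chain_with_rates ::
    "('x \<Rightarrow> 'x \<Rightarrow> real) \<Rightarrow> ('x \<Rightarrow> 'w measure) \<Rightarrow> (real \<Rightarrow> 'w \<Rightarrow> 'x) \<Rightarrow> bool" where
  "markov_chain_with_rates Q Pr X \<longleftrightarrow>
     (\<forall>x. prob_space (Pr x)) \<and>
     (\<forall>x. \<forall>t\<ge>0. X t \<in> measurable (Pr x) (count_space UNIV)) \<and>
     (\<forall>x. AE \<omega> in Pr x. X 0 \<omega> = x) \<and>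
     (\<forall>x. \<forall>\<omega>\<in>space (Pr x). \<forall>t\<ge>0. \<exists>\<epsilon>>0. \<forall>s\<in>{t..<t + \<epsilon>}. X s \<omega> = X t \<omega>) \<and>
     (\<forall>x n \<tau> \<xi>. 0 \<le> \<tau> 0 \<and> (\<forall>k\<le>n. \<tau> k \<le> \<tau> (Suc k)) \<longrightarrow>
        measure (Pr x) {\<omega> \<in> space (Pr x). \<forall>k\<le>Suc n. X (\<tau> k) \<omega> = \<xi> k} =
        measure (Pr x) {\<omega> \<in> space (Pr x). \<forall>k\<le>n. X (\<tau> k) \<omega> = \<xi> k} *
          trans_prob Pr X (\<tau> (Suc n) - \<tau> n) (\<xi> n) (\<xi> (Suc n))) \<and>
     (\<forall>x y. x \<noteq> y \<longrightarrow> ((\<lambda>h. trans_prob Pr X h x y / h) \<longlongrightarrow> Q x y) (at_right 0)) \<and>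
     (\<forall>x. ((\<lambda>h. (1 - trans_prob Pr X h x x) / h) \<longlongrightarrow> (\<Sum>\<^sub>\<infinity>y\<in>-{x}. Q x y)) (at_right 0))"

definition irreducible_chain :: "('x \<Rightarrow> 'w measure) \<Rightarrow> (real \<Rightarrow> 'w \<Rightarrow> 'x) \<Rightarrow> bool" where
  "irreducible_chain Pr X \<longleftrightarrow> (\<forall>x y. \<exists>t\<ge>0. trans_prob Pr X t x y > 0)"

text \<open>
  First time at which a path is in \<open>x\<close> after having been outside of \<open>x\<close>; it is \<open>\<infinity>\<close> if there is
  no such time.
\<close>

definition return_time :: "(real \<Rightarrow> 'w \<Rightarrow> 'x) \<Rightarrow> 'x \<Rightarrow> 'w \<Rightarrow> ennreal" where
  "return_time X x \<omega> =
     (INF t\<in>{t. 0 \<le> t \<and> X t \<omega> = x \<and> (\<exists>s\<in>{0..<t}. X s \<omega> \<noteq> x)}. ennreal t)"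

definition positive_recurrent :: "('x \<Rightarrow> 'w measure) \<Rightarrow> (real \<Rightarrow> 'w \<Rightarrow> 'x) \<Rightarrow> bool" where
  "positive_recurrent Pr X \<longleftrightarrow> (\<forall>x. (\<integral>\<^sup>+\<omega>. return_time X x \<omega> \<partial>Pr x) < \<infinity>)"

definition ergodic :: "('x \<Rightarrow> 'w measure) \<Rightarrow> (real \<Rightarrow> 'w \<Rightarrow> 'x) \<Rightarrow> bool" where
  "ergodic Pr X \<longleftrightarrow> irreducible_chain Pr X \<and> positive_recurrent Pr X"

definition stationary_distribution ::
    "('x \<Rightarrow> 'w measure) \<Rightarrow> (real \<Rightarrow> 'w \<Rightarrow> 'x) \<Rightarrow> 'x pmf \<Rightarrow> bool" where
  "stationary_distribution Pr X p \<longleftrightarrow>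
     (\<forall>t\<ge>0. \<forall>y. ((\<lambda>x. pmf p x * trans_prob Pr X t x y) has_sum pmf p y) UNIV)"


section \<open>Networks and the load balancing process\<close>

text \<open>
  The finite nonempty sets of dispatchers and servers are the finite types \<open>'d\<close> and \<open>'s\<close>.
\<close>

definition servers_of :: "('d \<times> 's) set \<Rightarrow> 'd \<Rightarrow> 's set" where
  "servers_of E d = {u. (d, u) \<in> E}"

definition dispatchers_of :: "('d \<times> 's) set \<Rightarrow> 's \<Rightarrow> 'd set" where
  "dispatchers_of E u = {d. (d, u) \<in> E}"

definition no_isolated_nodes :: "('d \<times> 's) set \<Rightarrow> bool" where
  "no_isolated_nodes E \<longleftrightarrow> (\<forall>d. servers_of E d \<noteq> {}) \<and> (\<forall>u. dispatchers_of E u \<noteq> {})"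

definition mean_degree :: "('d::finite \<times> 's::finite) set \<Rightarrow> real" where
  "mean_degree E = (\<Sum>d\<in>UNIV. real (card (servers_of E d))) / real CARD('d)"

definition shortest_queues :: "('d \<times> 's) set \<Rightarrow> ('s \<Rightarrow> nat) \<Rightarrow> 'd \<Rightarrow> 's set" where
  "shortest_queues E x d = {u \<in> servers_of E d. x u = Min (x ` servers_of E d)}"

definition arrival_rate ::
    "('d::finite \<times> 's::finite) set \<Rightarrow> ('d \<Rightarrow> real) \<Rightarrow> ('s \<Rightarrow> nat) \<Rightarrow> 's \<Rightarrow> real" where
  "arrival_rate E lam x u =
     (\<Sum>d\<in>dispatchers_of E u.
        lam d * of_bool (u \<in> shortest_queues E x d) / real (card (shortest_queues E x d)))"

definition departure_rate :: "('s \<Rightarrow> real) \<Rightarrow> ('s \<Rightarrow> nat) \<Rightarrow> 's \<Rightarrow> real" where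
  "departure_rate mu x u = mu u * of_bool (x u > 0)"

text \<open>
  The truncated subtraction is harmless because the departure rate vanishes when \<open>x u = 0\<close>.
\<close>

definition load_balancing_rates ::
    "('d::finite \<times> 's::finite) set \<Rightarrow> ('d \<Rightarrow> real) \<Rightarrow> ('s \<Rightarrow> real) \<Rightarrow>
     ('s \<Rightarrow> nat) \<Rightarrow> ('s \<Rightarrow> nat) \<Rightarrow> real" where
  "load_balancing_rates E lam mu x y =
     (\<Sum>u\<in>UNIV. arrival_rate E lam x u * of_bool (y = x(u := x u + 1))) +
     (\<Sum>u\<in>UNIV. departure_rate mu x u * of_bool (y = x(u := x u - 1)))"

definition load_balancing_process ::
    "('d::finite \<times> 's::finite) set \<Rightarrow> ('d \<Rightarrow> real) \<Rightarrow> ('s \<Rightarrow> real) \<Rightarrow>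
     (('s \<Rightarrow> nat) \<Rightarrow> 'w measure) \<Rightarrow> (real \<Rightarrow> 'w \<Rightarrow> ('s \<Rightarrow> nat)) \<Rightarrow> bool" where
  "load_balancing_process E lam mu Pr X \<longleftrightarrow>
     markov_chain_with_rates (load_balancing_rates E lam mu) Pr X"

definition occupancy :: "('s::finite \<Rightarrow> nat) \<Rightarrow> nat \<Rightarrow> real" where
  "occupancy x i = (\<Sum>u\<in>UNIV. of_bool (x u \<ge> i)) / real CARD('s)"

definition r :: "real \<Rightarrow> real \<Rightarrow> real" where
  "r \<rho> x = (\<rho> / x) powr x"

end

theory Submission
  imports Defs
begin

text \<open>
  The bound follows from balance of probability flux in stationarity: for every set \<open>A\<close> of states,
  the expected rate of entering \<open>A\<close> equals the expected rate of leaving it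
  (\<open>stationary_flux_balance\<close>).  Two families of sets are used.  Write \<open>\<rho> = lam0 / mu0\<close>.

  For \<open>A = {x. j \<le> x u}\<close>, summed over the levels \<open>j > i\<close> and the servers \<open>u\<close>, balance says that
  departures from servers with more than \<open>i\<close> tasks match arrivals at servers with at least \<open>i\<close> tasks.
  A dispatcher whose servers all have at least \<open>i\<close> tasks sends all its tasks there, so
  \<open>\<Sum>u. P(X u \<ge> i + 1)\<close> is at least \<open>\<rho>\<close> times \<open>\<Sum>d. P(all servers of d have at least i tasks)\<close>
  (\<open>sum_server_tails_ge\<close>).

  To bound the latter probabilities, fix a dispatcher with \<open>n\<close> servers and let \<open>T\<close> be the sum over
  these servers of the queue lengths capped at \<open>i\<close>.  While \<open>T < n i\<close>, the shortest queue of the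
  dispatcher is below the cap and each of its tasks increases \<open>T\<close>.  Flux balance for \<open>{T > k}\<close>
  therefore gives \<open>\<rho> P(T = k) \<le> n P(T = k + 1)\<close> for \<open>k < n i\<close> (\<open>capped_total_birth_death\<close>).  Hence
  the mass of \<open>T\<close> decreases at most geometrically, and the event \<open>T = n i\<close> that all the
  queues have reached \<open>i\<close> has probability at least \<open>(\<rho> / (n + 1)) ^ (n i) / (n + 1)\<close>, which is at
  least \<open>r \<rho> (n + 1) ^ i / (n + 1)\<close> (\<open>all_servers_filled_ge\<close>).

  Finally \<open>r \<rho> y ^ i / y\<close> is convex in \<open>y > \<rho>\<close>, so by Jensen's inequality the average over the
  dispatchers is at least the value for the mean degree \<open>\<beta>\<close>, and there are at least \<open>1 / \<beta>\<close>
  dispatchers per server.  This gives the bound with the prefactor \<open>\<rho> / \<beta>\<close>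
  (\<open>stationary_occupancy_ge\<close>), which exceeds \<open>\<rho> / (\<beta> (\<beta> + 1) + \<rho>)\<close>.
\<close>

section \<open>Stationary flux balance for Markov chains\<close>

text \<open>
  The law of \<open>X t\<close> has a probability mass function because \<open>'x\<close> is countable; as a \<open>pmf\<close>,
  the kernel can be composed with a stationary distribution by \<open>bind_pmf\<close>.
\<close>

definition transition_pmf ::
    "('x::countable \<Rightarrow> 'w measure) \<Rightarrow> (real \<Rightarrow> 'w \<Rightarrow> 'x) \<Rightarrow> real \<Rightarrow> 'x \<Rightarrow> 'x pmf" where
  "transition_pmf Pr X t x = Abs_pmf (distr (Pr x) (count_space UNIV) (X t))"

lemma pmf_transition_pmf:
  fixes x :: "'x::countable"
  assumes chain: "markov_chain_with_rates Q Pr X" and t: "0 \<le> t"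
  shows "pmf (transition_pmf Pr X t x) y = trans_prob Pr X t x y"
proof -
  have prob: "prob_space (Pr x)"
    and meas [measurable]: "X t \<in> measurable (Pr x) (count_space UNIV)"
    using chain t unfolding markov_chain_with_rates_def by auto
  let ?M = "distr (Pr x) (count_space UNIV) (X t)"
  interpret M: prob_space ?M
    using prob by (rule prob_space.prob_space_distr) simp
  have "AE z in ?M. measure ?M {z} \<noteq> 0"
    by (subst M.AE_support_countable) (auto intro!: exI[of _ UNIV])
  then have "measure_pmf (transition_pmf Pr X t x) = ?M"
    unfolding transition_pmf_def
    by (intro Abs_pmf_inverse) (simp add: M.prob_space_axioms)
  then have "pmf (transition_pmf Pr X t x) y = measure ?M {y}"
    by (simp add: pmf.rep_eq)
  also have "\<dots> = trans_prob Pr X t x y"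
    unfolding trans_prob_def by (subst measure_distr) (auto intro!: arg_cong[where f="measure _"])
  finally show ?thesis .
qed

text \<open>
  The stationarity equations are given for single states; this form yields them for all events
  at once.
\<close>

lemma stationary_bind_transition_pmf:
  fixes p :: "'x::countable pmf"
  assumes chain: "markov_chain_with_rates Q Pr X"
    and stat: "stationary_distribution Pr X p" and t: "0 \<le> t"
  shows "bind_pmf p (transition_pmf Pr X t) = p"
proof (rule pmf_eqI)
  fix y
  let ?f = "\<lambda>x. pmf p x * trans_prob Pr X t x y"
  have sum: "(?f has_sum pmf p y) UNIV"
    using stat t by (simp add: stationary_distribution_def)
  have nonneg: "0 \<le> ?f x" for x
    by (simp add: trans_prob_def)
  have "(\<lambda>x. norm (?f x)) summable_on UNIV"
    using sum nonneg by (auto simp: summable_on_def)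
  then have "infsetsum ?f UNIV = infsum ?f UNIV"
    by (intro infsetsum_infsum abs_summable_equivalent[THEN iffD1])
  then have eq: "infsetsum ?f UNIV = pmf p y"
    using infsumI[OF sum] by simp
  have "pmf (bind_pmf p (transition_pmf Pr X t)) y = (\<integral>x. trans_prob Pr X t x y \<partial>measure_pmf p)"
    by (simp add: pmf_bind pmf_transition_pmf[OF chain t])
  also have "\<dots> = infsetsum ?f UNIV"
    unfolding measure_pmf_eq_density infsetsum_def
    by (subst integral_density) simp_all
  finally show "pmf (bind_pmf p (transition_pmf Pr X t)) y = pmf p y"
    using eq by simp
qed

lemma trans_prob_tendsto_rate:
  assumes "markov_chain_with_rates Q Pr X" and "x \<noteq> y"
  shows "((\<lambda>h. trans_prob Pr X h x y / h) \<longlongrightarrow> Q x y) (at_right 0)"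
proof -
  have "\<forall>x y. x \<noteq> y \<longrightarrow> ((\<lambda>h. trans_prob Pr X h x y / h) \<longlongrightarrow> Q x y) (at_right 0)"
    using assms(1) unfolding markov_chain_with_rates_def by (elim conjE)
  then show ?thesis
    using assms(2) by blast
qed

lemma trans_prob_tendsto_exit_rate:
  assumes "markov_chain_with_rates Q Pr X"
  shows "((\<lambda>h. (1 - trans_prob Pr X h x x) / h) \<longlongrightarrow> (\<Sum>\<^sub>\<infinity>y\<in>-{x}. Q x y)) (at_right 0)"
proof -
  have "\<forall>x. ((\<lambda>h. (1 - trans_prob Pr X h x x) / h) \<longlongrightarrow> (\<Sum>\<^sub>\<infinity>y\<in>-{x}. Q x y)) (at_right 0)"
    using assms(1) unfolding markov_chain_with_rates_def by (elim conjE)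
  then show ?thesis
    by blast
qed

text \<open>
  One way of being back in \<open>x\<close> at time \<open>s + t\<close> is to be there at time \<open>s\<close> as well, and the Markov
  property gives this event the probability on the left.
\<close>

lemma trans_prob_diag_add_ge:
  assumes chain: "markov_chain_with_rates Q Pr X" and "0 \<le> s" "0 \<le> t"
  shows "trans_prob Pr X s x x * trans_prob Pr X t x x \<le> trans_prob Pr X (s + t) x x"
proof -
  let ?\<tau> = "\<lambda>k::nat. if k = 0 then s else s + t"
  interpret prob_space "Pr x"
    using chain by (simp add: markov_chain_with_rates_def)
  have meas [measurable]: "X t' \<in> measurable (Pr x) (count_space UNIV)" if "0 \<le> t'" for t'
    using chain that by (simp add: markov_chain_with_rates_def)
  have markov: "\<And>n \<tau> \<xi>. 0 \<le> \<tau> 0 \<and> (\<forall>k\<le>n. \<tau> k \<le> \<tau> (Suc k)) \<Longrightarrow>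
        measure (Pr x) {\<omega> \<in> space (Pr x). \<forall>k\<le>Suc n. X (\<tau> k) \<omega> = \<xi> k} =
        measure (Pr x) {\<omega> \<in> space (Pr x). \<forall>k\<le>n. X (\<tau> k) \<omega> = \<xi> k} *
          trans_prob Pr X (\<tau> (Suc n) - \<tau> n) (\<xi> n) (\<xi> (Suc n))"
    using chain unfolding markov_chain_with_rates_def by blast
  have "trans_prob Pr X s x x * trans_prob Pr X t x x =
      measure (Pr x) {\<omega> \<in> space (Pr x). \<forall>k\<le>Suc 0. X (?\<tau> k) \<omega> = x}"
    using markov[of ?\<tau> 0 "\<lambda>_. x"] assms(2,3) by (simp add: trans_prob_def)
  also have "\<dots> \<le> measure (Pr x) {\<omega> \<in> space (Pr x). X (s + t) \<omega> = x}"
  proof (rule finite_measure_mono)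
    show "{\<omega> \<in> space (Pr x). X (s + t) \<omega> = x} \<in> sets (Pr x)"
      using meas[of "s + t"] assms(2,3)
      by (intro measurable_sets_Collect[of "X (s+t)" _ "count_space UNIV"]) auto
  qed (auto dest: spec[of _ "Suc 0"])
  finally show ?thesis
    by (simp add: trans_prob_def)
qed

lemma trans_prob_diag_power_le:
  assumes chain: "markov_chain_with_rates Q Pr X" and "0 \<le> t"
  shows "trans_prob Pr X t x x ^ Suc n \<le> trans_prob Pr X (real (Suc n) * t) x x"
proof (induction n)
  case (Suc n)
  have "trans_prob Pr X t x x ^ Suc (Suc n) \<le> trans_prob Pr X t x x * trans_prob Pr X (real (Suc n) * t) x x"
    unfolding power_Suc[of _ "Suc n"]
    using Suc by (intro mult_left_mono) (auto simp: trans_prob_def)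
  also have "\<dots> \<le> trans_prob Pr X (t + real (Suc n) * t) x x"
    using assms by (intro trans_prob_diag_add_ge) auto
  finally show ?case
    by (simp add: algebra_simps)
qed simp

lemma filterlim_divide_Suc_at_right:
  fixes h :: real
  assumes "0 < h"
  shows "filterlim (\<lambda>n. h / real (Suc n)) (at_right 0) sequentially"
  using assms
  by (intro tendsto_imp_filterlim_at_right LIMSEQ_Suc[OF lim_const_over_n] always_eventually) auto

text \<open>
  The infinitesimal description only gives this bound in the limit \<open>h \<rightarrow> 0\<close>.  It is made uniform
  by splitting \<open>[0, h]\<close> into many short pieces of length \<open>h / n\<close>: being in \<open>x\<close> at the end of each
  piece implies being there at time \<open>h\<close>, so by Bernoulli's inequality
  \<open>1 - P\<^sub>h(x,x) \<le> n (1 - P\<^sub>h\<^sub>/\<^sub>n(x,x))\<close>, and the right-hand side tends to \<open>h\<close> times the exit rate.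
  This uniformity in \<open>h\<close> is what permits dominated convergence below.
\<close>

lemma exit_prob_le:
  fixes x :: "'x::countable"
  assumes chain: "markov_chain_with_rates Q Pr X" and h: "0 < h"
  shows "1 - trans_prob Pr X h x x \<le> (\<Sum>\<^sub>\<infinity>y\<in>-{x}. Q x y) * h"
proof (rule LIMSEQ_le_const)
  let ?e = "\<lambda>t. (1 - trans_prob Pr X t x x) / t"
  have "filterlim (\<lambda>n. h / real (Suc n)) (at_right 0) sequentially"
    using h by (rule filterlim_divide_Suc_at_right)
  moreover have "(?e \<longlongrightarrow> (\<Sum>\<^sub>\<infinity>y\<in>-{x}. Q x y)) (at_right 0)"
    by (rule trans_prob_tendsto_exit_rate[OF chain])
  ultimately have "(\<lambda>n. ?e (h / real (Suc n))) \<longlonglongrightarrow> (\<Sum>\<^sub>\<infinity>y\<in>-{x}. Q x y)"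
    by (rule filterlim_compose[rotated])
  then show "(\<lambda>n. ?e (h / real (Suc n)) * h) \<longlonglongrightarrow> (\<Sum>\<^sub>\<infinity>y\<in>-{x}. Q x y) * h"
    by (intro tendsto_intros)
  have "1 - trans_prob Pr X h x x \<le> ?e (h / real (Suc n)) * h" for n
  proof -
    let ?q = "trans_prob Pr X (h / real (Suc n)) x x"
    have "1 + real (Suc n) * (?q - 1) \<le> (1 + (?q - 1)) ^ Suc n"
      by (rule Bernoulli_inequality) (simp add: trans_prob_def)
    also have "\<dots> \<le> trans_prob Pr X (real (Suc n) * (h / real (Suc n))) x x"
      using trans_prob_diag_power_le[OF chain, of "h / real (Suc n)" x n] h by simp
    also have "real (Suc n) * (h / real (Suc n)) = h"
      by simp
    finally have "1 - trans_prob Pr X h x x \<le> real (Suc n) * (1 - ?q)"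
      by (simp add: algebra_simps)
    also have "\<dots> = ?e (h / real (Suc n)) * h"
      using h by simp
    finally show ?thesis .
  qed
  then show "\<exists>N. \<forall>n\<ge>N. 1 - trans_prob Pr X h x x \<le> ?e (h / real (Suc n)) * h"
    by blast
qed

text \<open>
  The definition of the chain gives only entrywise derivatives.  To pass to the mass of an
  arbitrary, possibly infinite, event \<open>A\<close>, jumps to states outside the finite set \<open>S\<close> must be
  negligible.  They are, because the exit rate equals the sum of the rates into \<open>S\<close>: no mass
  escapes to the remaining states at first order in \<open>h\<close>.
\<close>

lemma transition_pmf_derivative:
  fixes x :: "'x::countable"
  assumes chain: "markov_chain_with_rates Q Pr X"
    and fin: "finite S" and Q0: "\<And>y. y \<noteq> x \<Longrightarrow> y \<notin> S \<Longrightarrow> Q x y = 0"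
  shows "((\<lambda>h. (measure (transition_pmf Pr X h x) A - indicator A x) / h) \<longlongrightarrow>
      (\<Sum>y\<in>S. Q x y * (indicator A y - indicator A x))) (at_right 0)"
proof -
  define F where "F = S - {x}"
  have finF: "finite F" and xF: "x \<notin> F"
    using fin by (auto simp: F_def)
  let ?P = "\<lambda>h y. trans_prob Pr X h x y"
  let ?K = "\<lambda>h. transition_pmf Pr X h x"
  let ?d = "\<lambda>y. indicator A y - indicator A x :: real"
  let ?R = "\<lambda>h. (1 - ?P h x) / h - (\<Sum>y\<in>F. ?P h y / h)"
  have lim: "((\<lambda>h. ?P h y / h) \<longlongrightarrow> Q x y) (at_right 0)" if "y \<in> F" for y
    by (rule trans_prob_tendsto_rate[OF chain]) (use that xF in auto)
  have "((\<lambda>h. (1 - ?P h x) / h) \<longlongrightarrow> (\<Sum>\<^sub>\<infinity>y\<in>-{x}. Q x y)) (at_right 0)"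
    by (rule trans_prob_tendsto_exit_rate[OF chain])
  also have "(\<Sum>\<^sub>\<infinity>y\<in>-{x}. Q x y) = (\<Sum>\<^sub>\<infinity>y\<in>F. Q x y)"
    using Q0 by (intro infsum_cong_neutral) (auto simp: F_def)
  also have "\<dots> = (\<Sum>y\<in>F. Q x y)"
    using finF by simp
  finally have "(?R \<longlongrightarrow> (\<Sum>y\<in>F. Q x y) - (\<Sum>y\<in>F. Q x y)) (at_right 0)"
    by (intro tendsto_intros lim)
  then have R: "(?R \<longlongrightarrow> 0) (at_right 0)"
    by simp
  have est: "norm ((measure (?K h) A - indicator A x) / h - (\<Sum>y\<in>F. ?P h y / h * ?d y)) \<le> ?R h"
    if h: "0 < h" for h
  proof -
    have P: "?P h y = (\<integral>z. indicator {y} z \<partial>measure_pmf (?K h))" for y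
      using pmf_transition_pmf[OF chain, of h x y] h by (simp add: pmf.rep_eq)
    have int [simp]: "integrable (measure_pmf (?K h)) (indicator B :: 'x \<Rightarrow> real)" for B
      by (rule measure_pmf.integrable_const_bound[of _ 1]) (auto simp: indicator_def)
    have "measure (?K h) A - indicator A x - (\<Sum>y\<in>F. ?P h y * ?d y) =
        (\<integral>z. indicator A z - indicator A x - (\<Sum>y\<in>F. indicator {y} z * ?d y) \<partial>measure_pmf (?K h))"
      by (simp add: P del: integral_indicator) 
    also have "norm \<dots> \<le>
        (\<integral>z. norm (indicator A z - indicator A x - (\<Sum>y\<in>F. indicator {y} z * ?d y)) \<partial>measure_pmf (?K h))"
      by (rule integral_norm_bound)
    (* The integrand vanishes on F and at x, and is at most 1 elsewhere. *)
    also have "\<dots> \<le> (\<integral>z. 1 - indicator {x} z - (\<Sum>y\<in>F. indicator {y} z) \<partial>measure_pmf (?K h))"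
    proof (rule integral_mono)
      fix z
      show "norm (indicator A z - indicator A x - (\<Sum>y\<in>F. indicator {y} z * ?d y)) \<le>
         1 - indicator {x} z - (\<Sum>y\<in>F. indicator {y} z :: real)"
      proof (cases "z \<in> F")
        case True
        have 1: "(\<Sum>y\<in>F. indicator {y} z * ?d y) = ?d z"
          using True finF by (simp add: indicator_def sum.remove[of F z] cong: if_cong)
        have 2: "(\<Sum>y\<in>F. indicator {y} z) = (1::real)"
          using True finF by (simp add: indicator_def sum.remove[of F z] cong: if_cong)
        show ?thesis using xF True unfolding 1 2 by (auto simp: indicator_def)
      next
        case False
        have 1: "(\<Sum>y\<in>F. indicator {y} z * ?d y) = 0"
          using False by (intro sum.neutral) (auto simp: indicator_def)
        have 2: "(\<Sum>y\<in>F. indicator {y} z) = (0::real)"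
          using False by (intro sum.neutral) (auto simp: indicator_def)
        show ?thesis unfolding 1 2 by (auto simp: indicator_def)
      qed
    qed (auto intro!: Bochner_Integration.integrable_diff Bochner_Integration.integrable_sum
           integrable_norm integrable_mult_left)
    also have "\<dots> = 1 - ?P h x - (\<Sum>y\<in>F. ?P h y)"
      by (simp add: P del: integral_indicator)
    finally have "norm (measure (?K h) A - indicator A x - (\<Sum>y\<in>F. ?P h y * ?d y)) / h \<le>
        (1 - ?P h x - (\<Sum>y\<in>F. ?P h y)) / h"
      using h by (intro divide_right_mono) auto
    moreover have "(measure (?K h) A - indicator A x) / h - (\<Sum>y\<in>F. ?P h y / h * ?d y) =
        (measure (?K h) A - indicator A x - (\<Sum>y\<in>F. ?P h y * ?d y)) / h"
      by (simp add: diff_divide_distrib sum_divide_distrib)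
    moreover have "?R h = (1 - ?P h x - (\<Sum>y\<in>F. ?P h y)) / h"
      by (simp add: diff_divide_distrib sum_divide_distrib)
    ultimately show ?thesis
      using h by simp
  qed
  have "((\<lambda>h. (measure (?K h) A - indicator A x) / h - (\<Sum>y\<in>F. ?P h y / h * ?d y)) \<longlongrightarrow> 0) (at_right 0)"
  proof (rule tendsto_0_le[OF R, of _ 1])
    show "\<forall>\<^sub>F h in at_right 0.
        norm ((measure (?K h) A - indicator A x) / h - (\<Sum>y\<in>F. ?P h y / h * ?d y)) \<le> norm (?R h) * 1"
      using eventually_at_right_less[of 0]
    proof eventually_elim
      case (elim h)
      show ?case
        using order.trans[OF est[OF elim] abs_ge_self] by (simp only: real_norm_def mult_1_right)
    qed
  qed
  moreover have "((\<lambda>h. (\<Sum>y\<in>F. ?P h y / h * ?d y)) \<longlongrightarrow> (\<Sum>y\<in>F. Q x y * ?d y)) (at_right 0)"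
    by (intro tendsto_intros lim)
  ultimately have "((\<lambda>h. (measure (?K h) A - indicator A x) / h - (\<Sum>y\<in>F. ?P h y / h * ?d y) +
      (\<Sum>y\<in>F. ?P h y / h * ?d y)) \<longlongrightarrow> 0 + (\<Sum>y\<in>F. Q x y * ?d y)) (at_right 0)"
    by (rule tendsto_add)
  then have "((\<lambda>h. (measure (?K h) A - indicator A x) / h) \<longlongrightarrow> (\<Sum>y\<in>F. Q x y * ?d y)) (at_right 0)"
    by (simp only: diff_add_cancel add_0)
  also have "(\<Sum>y\<in>F. Q x y * ?d y) = (\<Sum>y\<in>S. Q x y * ?d y)"
    using fin by (intro sum.mono_neutral_left) (auto simp: F_def)
  finally show ?thesis .
qed

text \<open>
  In stationarity the probability of \<open>A\<close> does not change over a time step \<open>h\<close>.  Dividing the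
  expected change by \<open>h\<close> and letting \<open>h \<rightarrow> 0\<close> shows that the expected rate of entering \<open>A\<close> equals
  the expected rate of leaving it.  Bounded exit rates supply the dominating function, by
  \<open>exit_prob_le\<close>.
\<close>

lemma stationary_flux_balance:
  fixes p :: "'x::countable pmf"
  assumes chain: "markov_chain_with_rates Q Pr X"
    and stat: "stationary_distribution Pr X p"
    and fin: "\<And>x. finite (S x)" and Q0: "\<And>x y. y \<noteq> x \<Longrightarrow> y \<notin> S x \<Longrightarrow> Q x y = 0"
    and bound: "\<And>x. (\<Sum>y\<in>S x - {x}. Q x y) \<le> C"
  shows "(\<integral>x. (\<Sum>y\<in>S x. Q x y * (indicator A y - indicator A x)) \<partial>measure_pmf p) = 0"
proof -
  let ?h = "\<lambda>n. 1 / real (Suc n)"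
  let ?K = "\<lambda>n x. transition_pmf Pr X (?h n) x"
  let ?f = "\<lambda>n x. (measure (?K n x) A - indicator A x) / ?h n"
  have int [simp]: "integrable (measure_pmf p) (indicator A :: 'x \<Rightarrow> real)"
    by (rule measure_pmf.integrable_const_bound[of _ 1]) (auto simp: indicator_def)
  have int' [simp]: "integrable (measure_pmf p) (\<lambda>x. measure (?K n x) A)" for n
    by (rule measure_pmf.integrable_const_bound[of _ 1]) auto
  have zero: "(\<integral>x. ?f n x \<partial>measure_pmf p) = 0" for n
  proof -
    have "measure (measure_pmf p) A = measure (measure_pmf (bind_pmf p (?K n))) A"
      using stationary_bind_transition_pmf[OF chain stat, of "?h n"] by simp
    also have "\<dots> = (\<integral>x. measure (?K n x) A \<partial>measure_pmf p)"
      unfolding measure_pmf_bind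
      by (subst measure_pmf.measure_bind[where N = "count_space UNIV"])
         (auto simp: measure_pmf_in_subprob_algebra)
    finally have "(\<integral>x. measure (?K n x) A - indicator A x \<partial>measure_pmf p) = 0"
      by (subst Bochner_Integration.integral_diff[OF int' int]) simp
    then show ?thesis
      by (simp only: integral_divide_zero div_0)
  qed
  have lim: "filterlim ?h (at_right 0) sequentially"
    by (rule filterlim_divide_Suc_at_right) simp
  have "(\<lambda>n. \<integral>x. ?f n x \<partial>measure_pmf p) \<longlonglongrightarrow>
      (\<integral>x. (\<Sum>y\<in>S x. Q x y * (indicator A y - indicator A x)) \<partial>measure_pmf p)"
  proof (rule integral_dominated_convergence[where w = "\<lambda>_. C"])
    show "AE x in measure_pmf p. (\<lambda>n. ?f n x) \<longlonglongrightarrow>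
        (\<Sum>y\<in>S x. Q x y * (indicator A y - indicator A x))"
    proof (intro AE_I2)
      fix x
      show "(\<lambda>n. ?f n x) \<longlonglongrightarrow> (\<Sum>y\<in>S x. Q x y * (indicator A y - indicator A x))"
        by (rule filterlim_compose[OF transition_pmf_derivative[OF chain fin Q0] lim])
    qed
    show "AE x in measure_pmf p. norm (?f n x) \<le> C" for n
    proof (intro AE_I2)
      fix x
      have x: "pmf (?K n x) x = trans_prob Pr X (?h n) x x"
        by (rule pmf_transition_pmf[OF chain]) simp
      have "\<bar>measure (?K n x) A - indicator A x\<bar> \<le> 1 - measure (?K n x) {x}"
      proof (cases "x \<in> A")
        case True
        then have "measure (?K n x) {x} \<le> measure (?K n x) A"
          by (intro measure_pmf.finite_measure_mono) auto
        then show ?thesis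
          using True by simp
      next
        case False
        then have "measure (?K n x) A \<le> measure (?K n x) (- {x})"
          by (intro measure_pmf.finite_measure_mono) auto
        also have "\<dots> = 1 - measure (?K n x) {x}"
          using measure_pmf.prob_compl[of "{x}" "?K n x"] by (simp add: Compl_eq_Diff_UNIV)
        finally show ?thesis
          using False by simp
      qed
      also have "\<dots> = 1 - trans_prob Pr X (?h n) x x"
        using x by (simp only: pmf.rep_eq)
      also have "\<dots> \<le> (\<Sum>\<^sub>\<infinity>y\<in>-{x}. Q x y) * ?h n"
        by (rule exit_prob_le[OF chain]) simp
      also have "(\<Sum>\<^sub>\<infinity>y\<in>-{x}. Q x y) = (\<Sum>\<^sub>\<infinity>y\<in>S x - {x}. Q x y)"
        using Q0 by (intro infsum_cong_neutral) auto
      also have "\<dots> = (\<Sum>y\<in>S x - {x}. Q x y)"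
        using fin by simp
      also have "\<dots> * ?h n \<le> C * ?h n"
        using bound by (intro mult_right_mono) auto
      finally have "\<bar>measure (?K n x) A - indicator A x\<bar> \<le> C * ?h n" .
      then show "norm (?f n x) \<le> C"
        unfolding real_norm_def abs_divide by (subst pos_divide_le_eq) simp_all
    qed
  qed auto
  then show ?thesis
    by (simp only: zero LIMSEQ_const_iff)
qed

section \<open>Flux balance for the load balancing process\<close>

lemma integrable_pmf_bounded:
  fixes f :: "'a \<Rightarrow> real"
  assumes "\<And>x. \<bar>f x\<bar> \<le> C"
  shows "integrable (measure_pmf p) f"
  using assms by (intro measure_pmf.integrable_const_bound[of _ C]) auto

lemma arrival_rate_nonneg:
  assumes "\<And>d. 0 \<le> lam d"
  shows "0 \<le> arrival_rate E lam x u"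
  unfolding arrival_rate_def using assms by (intro sum_nonneg divide_nonneg_nonneg) auto

lemma arrival_rate_le:
  assumes lam: "\<And>d. 0 \<le> lam d"
  shows "arrival_rate E lam x u \<le> (\<Sum>d\<in>UNIV. lam d)"
proof -
  have "arrival_rate E lam x u \<le> (\<Sum>d\<in>dispatchers_of E u. lam d)"
    unfolding arrival_rate_def
  proof (rule sum_mono)
    fix d
    let ?S = "shortest_queues E x d"
    show "lam d * of_bool (u \<in> ?S) / real (card ?S) \<le> lam d"
    proof (cases "u \<in> ?S")
      case True
      then have "1 \<le> card ?S"
        by (metis One_nat_def Suc_leI card_gt_0_iff empty_iff finite)
      then have "lam d / real (card ?S) \<le> lam d / 1"
        using lam[of d] by (intro divide_left_mono) auto
      then show ?thesis
        using True by simp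
    qed (use lam in simp)
  qed
  also have "\<dots> \<le> (\<Sum>d\<in>UNIV. lam d)"
    using lam by (intro sum_mono2) auto
  finally show ?thesis .
qed

lemma sum_arrival_rate:
  "(\<Sum>u\<in>B. arrival_rate E lam x u) =
     (\<Sum>d\<in>UNIV. lam d * (real (card (B \<inter> shortest_queues E x d)) / real (card (shortest_queues E x d))))"
proof -
  let ?S = "shortest_queues E x"
  have arr: "arrival_rate E lam x u = (\<Sum>d\<in>UNIV. lam d * of_bool (u \<in> ?S d) / real (card (?S d)))" for u
    unfolding arrival_rate_def
    by (rule sum.mono_neutral_left) (auto simp: dispatchers_of_def shortest_queues_def servers_of_def)
  have inner: "(\<Sum>u\<in>B. lam d * of_bool (u \<in> ?S d) / real (card (?S d))) =
      lam d * (real (card (B \<inter> ?S d)) / real (card (?S d)))" for d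
  proof -
    have "(\<Sum>u\<in>B. of_bool (u \<in> ?S d)) = real (card (B \<inter> ?S d))"
      by simp
    then show ?thesis
      by (simp only: sum_divide_distrib[symmetric] sum_distrib_left[symmetric] times_divide_eq_right)
  qed
  show ?thesis
    unfolding arr by (subst sum.swap) (simp only: inner)
qed

lemma shortest_queues_nonempty:
  fixes E :: "('d::finite \<times> 's::finite) set"
  assumes "servers_of E d \<noteq> {}"
  shows "shortest_queues E x d \<noteq> {}"
proof -
  have "Min (x ` servers_of E d) \<in> x ` servers_of E d"
    using assms by (intro Min_in) auto
  then show ?thesis
    by (auto simp: shortest_queues_def)
qed

text \<open>
  A dispatcher all of whose candidate servers lie in \<open>B\<close> directs its whole arrival stream
  into \<open>B\<close>, whatever the tie-breaking.
\<close>

lemma sum_arrival_rate_ge: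
  assumes "\<And>d. 0 \<le> lam d" and "\<And>d. d \<in> F \<Longrightarrow> servers_of E d \<noteq> {}"
    and "\<And>d. d \<in> F \<Longrightarrow> shortest_queues E x d \<subseteq> B"
  shows "(\<Sum>d\<in>F. lam d) \<le> (\<Sum>u\<in>B. arrival_rate E lam x u)"
proof -
  let ?S = "shortest_queues E x"
  let ?t = "\<lambda>d. lam d * (real (card (B \<inter> ?S d)) / real (card (?S d)))"
  have "(\<Sum>d\<in>F. lam d) = (\<Sum>d\<in>F. ?t d)"
  proof (rule sum.cong)
    fix d assume d: "d \<in> F"
    have "card (?S d) \<noteq> 0"
      using shortest_queues_nonempty[OF assms(2)[OF d]] by simp
    then show "lam d = ?t d"
      using assms(3)[OF d] by (simp add: Int_absorb1)
  qed simp
  also have "\<dots> \<le> (\<Sum>d\<in>UNIV. ?t d)"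
    using assms(1) by (intro sum_mono2) auto
  also have "\<dots> = (\<Sum>u\<in>B. arrival_rate E lam x u)"
    by (simp only: sum_arrival_rate)
  finally show ?thesis .
qed

lemma departure_rate_bounds:
  assumes "\<And>u. 0 \<le> mu u"
  shows "0 \<le> departure_rate mu x u" "departure_rate mu x u \<le> mu u"
  using assms by (auto simp: departure_rate_def)

lemma sum_load_balancing_rates:
  fixes x :: "'s::finite \<Rightarrow> nat"
  assumes "finite F" and "\<And>u. x(u := x u + 1) \<in> F" and "\<And>u. x(u := x u - 1) \<in> F"
  shows "(\<Sum>y\<in>F. load_balancing_rates E lam mu x y * g y) =
      (\<Sum>u\<in>UNIV. arrival_rate E lam x u * g (x(u := x u + 1))) +
      (\<Sum>u\<in>UNIV. departure_rate mu x u * g (x(u := x u - 1)))"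
proof -
  have reindex: "(\<Sum>y\<in>F. (\<Sum>u\<in>UNIV. a u * of_bool (y = f u)) * g y) = (\<Sum>u\<in>UNIV. a u * g (f u))"
    if "\<And>u. f u \<in> F" for f :: "'s \<Rightarrow> 's \<Rightarrow> nat" and a :: "'s \<Rightarrow> real"
  proof -
    have inner: "(\<Sum>y\<in>F. a u * of_bool (y = f u) * g y) = a u * g (f u)" for u
    proof -
      have "(\<Sum>y\<in>F. a u * of_bool (y = f u) * g y) = (\<Sum>y\<in>{f u}. a u * of_bool (y = f u) * g y)"
        using assms(1) that by (intro sum.mono_neutral_right) auto
      then show ?thesis
        by simp
    qed
    show ?thesis
      unfolding sum_distrib_right by (subst sum.swap) (simp only: inner)
  qed
  show ?thesis
    unfolding load_balancing_rates_def distrib_right sum.distrib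
    using assms(2,3) by (intro arg_cong2[where f = "(+)"] reindex) auto
qed

lemma load_balancing_flux_balance:
  fixes E :: "('d::finite \<times> 's::finite) set"
  assumes lam: "\<And>d. 0 \<le> lam d" and mu: "\<And>u. 0 \<le> mu u"
    and proc: "load_balancing_process E lam mu Pr X"
    and stat: "stationary_distribution Pr X p"
  shows "(\<integral>x. (\<Sum>u\<in>UNIV. arrival_rate E lam x u * (indicator A (x(u := x u + 1)) - indicator A x)) +
      (\<Sum>u\<in>UNIV. departure_rate mu x u * (indicator A (x(u := x u - 1)) - indicator A x))
      \<partial>measure_pmf p) = 0"
proof -
  let ?Q = "load_balancing_rates E lam mu"
  let ?S = "\<lambda>x::'s \<Rightarrow> nat. range (\<lambda>u. x(u := x u + 1)) \<union> range (\<lambda>u. x(u := x u - 1))"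
  let ?C = "(\<Sum>u\<in>(UNIV::'s set). \<Sum>d\<in>UNIV. lam d) + (\<Sum>u\<in>UNIV. mu u)"
  have Q_nonneg: "0 \<le> ?Q x y" for x y
    unfolding load_balancing_rates_def
    by (intro add_nonneg_nonneg sum_nonneg mult_nonneg_nonneg arrival_rate_nonneg lam
        departure_rate_bounds mu) auto
  have "(\<integral>x. (\<Sum>y\<in>?S x. ?Q x y * (indicator A y - indicator A x)) \<partial>measure_pmf p) = 0"
  proof (rule stationary_flux_balance[OF _ stat])
    show "markov_chain_with_rates ?Q Pr X"
      using proc by (simp add: load_balancing_process_def)
    show "?Q x y = 0" if "y \<noteq> x" "y \<notin> ?S x" for x y
    proof -
      have "y \<noteq> x(u := x u + 1)" "y \<noteq> x(u := x u - 1)" for u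
        using that by blast+
      then show ?thesis
        by (simp add: load_balancing_rates_def)
    qed
    show "(\<Sum>y\<in>?S x - {x}. ?Q x y) \<le> ?C" for x
    proof -
      have "(\<Sum>y\<in>?S x - {x}. ?Q x y) \<le> (\<Sum>y\<in>?S x. ?Q x y * 1)"
        using Q_nonneg by (auto intro!: sum_mono2)
      also have "\<dots> = (\<Sum>u\<in>UNIV. arrival_rate E lam x u * 1) + (\<Sum>u\<in>UNIV. departure_rate mu x u * 1)"
        by (rule sum_load_balancing_rates) auto
      also have "\<dots> \<le> ?C"
        using arrival_rate_le[OF lam] departure_rate_bounds[OF mu]
        by (intro add_mono sum_mono) auto
      finally show ?thesis .
    qed
  qed simp
  moreover have "(\<Sum>y\<in>?S x. ?Q x y * (indicator A y - indicator A x)) =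
      (\<Sum>u\<in>UNIV. arrival_rate E lam x u * (indicator A (x(u := x u + 1)) - indicator A x)) +
      (\<Sum>u\<in>UNIV. departure_rate mu x u * (indicator A (x(u := x u - 1)) - indicator A x))" for x
    by (rule sum_load_balancing_rates) auto
  ultimately show ?thesis
    by simp
qed

text \<open>
  Flux balance for the event \<open>{x. Suc j \<le> x u}\<close>: it can be entered only by an arrival at \<open>u\<close> from
  level \<open>j\<close>, and left only by a departure from level \<open>Suc j\<close>.
\<close>

lemma server_level_balance:
  fixes E :: "('d::finite \<times> 's::finite) set"
  assumes lam: "\<And>d. 0 \<le> lam d" and mu: "\<And>u. 0 \<le> mu u"
    and proc: "load_balancing_process E lam mu Pr X"
    and stat: "stationary_distribution Pr X p"
  shows "(\<integral>x. arrival_rate E lam x u * indicator {x. x u = j} x -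
      mu u * indicator {x. x u = Suc j} x \<partial>measure_pmf p) = 0"
proof -
  let ?A = "{x::'s \<Rightarrow> nat. Suc j \<le> x u}"
  have "(\<Sum>w\<in>UNIV. arrival_rate E lam x w * (indicator ?A (x(w := x w + 1)) - indicator ?A x)) +
      (\<Sum>w\<in>UNIV. departure_rate mu x w * (indicator ?A (x(w := x w - 1)) - indicator ?A x)) =
      arrival_rate E lam x u * indicator {x. x u = j} x - mu u * indicator {x. x u = Suc j} x" for x
  proof -
    have "(\<Sum>w\<in>UNIV. arrival_rate E lam x w * (indicator ?A (x(w := x w + 1)) - indicator ?A x)) =
        (\<Sum>w\<in>{u}. arrival_rate E lam x w * (indicator ?A (x(w := x w + 1)) - indicator ?A x))"
      by (rule sum.mono_neutral_right) (auto simp: indicator_def)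
    also have "\<dots> = arrival_rate E lam x u * indicator {x. x u = j} x"
      by (auto simp: indicator_def)
    finally have arr: "(\<Sum>w\<in>UNIV. arrival_rate E lam x w * (indicator ?A (x(w := x w + 1)) - indicator ?A x)) =
        arrival_rate E lam x u * indicator {x. x u = j} x" .
    have "(\<Sum>w\<in>UNIV. departure_rate mu x w * (indicator ?A (x(w := x w - 1)) - indicator ?A x)) =
        (\<Sum>w\<in>{u}. departure_rate mu x w * (indicator ?A (x(w := x w - 1)) - indicator ?A x))"
      by (rule sum.mono_neutral_right) (auto simp: indicator_def)
    also have "\<dots> = - mu u * indicator {x. x u = Suc j} x"
      by (auto simp: indicator_def departure_rate_def)
    finally show ?thesis
      using arr by simp
  qed
  then show ?thesis
    using load_balancing_flux_balance[OF lam mu proc stat, of ?A] by simp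
qed

text \<open>
  Sum of the level balances over all levels from \<open>i\<close> on.  The two tails are integrable because the
  rates are bounded, so it suffices to take finitely many levels and pass to the limit.
\<close>

lemma server_tail_balance:
  fixes E :: "('d::finite \<times> 's::finite) set"
  assumes lam: "\<And>d. 0 \<le> lam d" and mu: "\<And>u. 0 \<le> mu u"
    and proc: "load_balancing_process E lam mu Pr X"
    and stat: "stationary_distribution Pr X p"
  shows "mu u * measure (measure_pmf p) {x. Suc i \<le> x u} =
      (\<integral>x. arrival_rate E lam x u * indicator {x. i \<le> x u} x \<partial>measure_pmf p)"
proof -
  let ?L = "\<Sum>d\<in>UNIV. lam d"
  let ?a = "\<lambda>x. arrival_rate E lam x u"
  let ?f = "\<lambda>K x. ?a x * indicator {x. i \<le> x u \<and> x u < i + K} x -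
      mu u * indicator {x. Suc i \<le> x u \<and> x u < Suc i + K} x"
  have a: "\<bar>?a x\<bar> \<le> ?L" for x
    using arrival_rate_nonneg[of lam E x u, OF lam] arrival_rate_le[of lam E x u, OF lam] by simp
  have L: "0 \<le> ?L"
    using lam by (intro sum_nonneg)
  have ai: "\<bar>?a x * indicator B x\<bar> \<le> ?L" for B x
    using a L by (auto simp: indicator_def)
  have mi: "\<bar>mu u * indicator B x\<bar> \<le> mu u" for B and x :: "'s \<Rightarrow> nat"
    using mu[of u] by (auto simp: indicator_def)
  have int_a: "integrable (measure_pmf p) (\<lambda>x. ?a x * indicator B x)" for B
    by (rule integrable_pmf_bounded[OF ai])
  have int_m: "integrable (measure_pmf p) (\<lambda>x. mu u * indicator B x)" for B
    by (rule integrable_pmf_bounded[OF mi])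
  have zero: "(\<integral>x. ?f K x \<partial>measure_pmf p) = 0" for K
  proof (induction K)
    case (Suc K)
    have "?f (Suc K) x = ?f K x + (?a x * indicator {x. x u = i + K} x -
        mu u * indicator {x. x u = Suc (i + K)} x)" for x
      by (auto simp: indicator_def)
    then have "(\<integral>x. ?f (Suc K) x \<partial>measure_pmf p) = (\<integral>x. ?f K x \<partial>measure_pmf p) +
        (\<integral>x. ?a x * indicator {x. x u = i + K} x -
          mu u * indicator {x. x u = Suc (i + K)} x \<partial>measure_pmf p)"
      using int_a int_m by (simp only:) (intro Bochner_Integration.integral_add
          Bochner_Integration.integrable_diff)
    then show ?case
      using Suc server_level_balance[OF lam mu proc stat] by simp
  qed simp
  have "(\<lambda>K. \<integral>x. ?f K x \<partial>measure_pmf p) \<longlonglongrightarrow>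
      (\<integral>x. ?a x * indicator {x. i \<le> x u} x - mu u * indicator {x. Suc i \<le> x u} x \<partial>measure_pmf p)"
  proof (rule integral_dominated_convergence[where w = "\<lambda>_. ?L + mu u"])
    show "AE x in measure_pmf p. (\<lambda>K. ?f K x) \<longlonglongrightarrow>
        ?a x * indicator {x. i \<le> x u} x - mu u * indicator {x. Suc i \<le> x u} x"
    proof (intro AE_I2 tendsto_eventually)
      fix x
      show "\<forall>\<^sub>F K in sequentially. ?f K x =
          ?a x * indicator {x. i \<le> x u} x - mu u * indicator {x. Suc i \<le> x u} x"
        using eventually_ge_at_top[of "Suc (x u)"]
        by eventually_elim (auto simp: indicator_def)
    qed
    show "AE x in measure_pmf p. norm (?f K x) \<le> ?L + mu u" for K
      by (intro AE_I2 order.trans[OF norm_triangle_ineq4] add_mono)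
         (simp_all only: real_norm_def ai mi)
  qed auto
  then have "(\<integral>x. ?a x * indicator {x. i \<le> x u} x -
      mu u * indicator {x. Suc i \<le> x u} x \<partial>measure_pmf p) = 0"
    unfolding zero by (simp add: LIMSEQ_const_iff)
  then have "(\<integral>x. ?a x * indicator {x. i \<le> x u} x \<partial>measure_pmf p) =
      (\<integral>x. mu u * indicator {x. Suc i \<le> x u} x \<partial>measure_pmf p)"
    by (simp only: Bochner_Integration.integral_diff[OF int_a int_m])
  then show ?thesis
    by simp
qed

text \<open>
  This transfers a lower bound on all servers of a dispatcher at level \<open>i\<close> to a lower bound on
  the single servers at level \<open>i + 1\<close>: a dispatcher whose servers all have at least \<open>i\<close> tasks
  sends its arrivals to servers with at least \<open>i\<close> tasks, and by the tail balance these arrivals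
  are matched by departures from servers with at least \<open>i + 1\<close> tasks.  Counting the flux by
  dispatcher instead of by server makes the sharing of servers among dispatchers harmless.
\<close>

lemma sum_server_tails_ge:
  fixes E :: "('d::finite \<times> 's::finite) set"
  assumes E: "no_isolated_nodes E"
    and lam: "\<And>d. lam0 \<le> lam d" "0 \<le> lam0" and mu: "\<And>u. 0 \<le> mu u" "\<And>u. mu u \<le> mu0"
    and proc: "load_balancing_process E lam mu Pr X"
    and stat: "stationary_distribution Pr X p"
  shows "lam0 * (\<Sum>d\<in>UNIV. measure (measure_pmf p) {x. \<forall>v\<in>servers_of E d. i \<le> x v}) \<le>
      mu0 * (\<Sum>u\<in>UNIV. measure (measure_pmf p) {x. Suc i \<le> x u})"
proof -
  have lam': "0 \<le> lam d" for d
    using lam by (rule order.trans[rotated])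
  let ?G = "\<lambda>d. {x. \<forall>v\<in>servers_of E d. i \<le> x v}"
  let ?a = "\<lambda>x u. arrival_rate E lam x u * indicator {x. i \<le> x u} x"
  have ind [simp]: "integrable (measure_pmf p) (indicator B :: ('s \<Rightarrow> nat) \<Rightarrow> real)" for B
    by (rule integrable_pmf_bounded[of _ 1]) (auto simp: indicator_def)
  have int [simp]: "integrable (measure_pmf p) (\<lambda>x. ?a x u)" for u
  proof (rule integrable_pmf_bounded)
    show "\<bar>?a x u\<bar> \<le> (\<Sum>d\<in>UNIV. lam d)" for x
      using arrival_rate_nonneg[of lam E x u, OF lam'] arrival_rate_le[of lam E x u, OF lam'] lam'
      by (auto simp: indicator_def intro!: sum_nonneg)
  qed
  have "lam0 * (\<Sum>d\<in>UNIV. measure (measure_pmf p) (?G d)) =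
      (\<integral>x. (\<Sum>d\<in>UNIV. lam0 * indicator (?G d) x) \<partial>measure_pmf p)"
    by (subst Bochner_Integration.integral_sum) (simp_all add: sum_distrib_left)
  also have "\<dots> \<le> (\<integral>x. (\<Sum>u\<in>UNIV. ?a x u) \<partial>measure_pmf p)"
  proof (rule integral_mono)
    fix x :: "'s \<Rightarrow> nat"
    have "(\<Sum>d\<in>UNIV. lam0 * indicator (?G d) x) = (\<Sum>d\<in>{d. x \<in> ?G d}. lam0)"
      by (simp add: indicator_def sum.If_cases mult.commute)
    also have "\<dots> \<le> (\<Sum>d\<in>{d. x \<in> ?G d}. lam d)"
      using lam by (intro sum_mono)
    also have "\<dots> \<le> (\<Sum>u\<in>{u. i \<le> x u}. arrival_rate E lam x u)"
      using E lam' by (intro sum_arrival_rate_ge) (auto simp: no_isolated_nodes_def shortest_queues_def)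
    also have "\<dots> = (\<Sum>u\<in>UNIV. ?a x u)"
      by (simp add: indicator_def sum.If_cases)
    finally show "(\<Sum>d\<in>UNIV. lam0 * indicator (?G d) x) \<le> (\<Sum>u\<in>UNIV. ?a x u)" .
  qed (intro Bochner_Integration.integrable_sum integrable_mult_right ind int)+
  also have "\<dots> = (\<Sum>u\<in>UNIV. mu u * measure (measure_pmf p) {x. Suc i \<le> x u})"
    by (subst Bochner_Integration.integral_sum[OF int])
       (simp only: server_tail_balance[OF lam' mu(1) proc stat])
  also have "\<dots> \<le> mu0 * (\<Sum>u\<in>UNIV. measure (measure_pmf p) {x. Suc i \<le> x u})"
    unfolding sum_distrib_left using mu(2) by (intro sum_mono mult_right_mono) auto
  finally show ?thesis .
qed

section \<open>Filling the servers of one dispatcher\<close>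

text \<open>
  Going down from \<open>m\<close>, the mass grows by a factor of at most \<open>1 / b\<close> per step, so that the total
  mass \<open>1\<close> is at most \<open>pmf q m\<close> times \<open>\<Sum>k\<le>m. (1 / b) ^ k\<close>.
\<close>

lemma pmf_geometric_lower_bound:
  fixes q :: "nat pmf" and b :: real
  assumes supp: "set_pmf q \<subseteq> {..m}" and b: "0 < b" "b < 1"
    and step: "\<And>k. k < m \<Longrightarrow> b * pmf q k \<le> pmf q (Suc k)"
  shows "(1 - b) * b ^ m \<le> pmf q m"
proof -
  have down: "b ^ j * pmf q (m - j) \<le> pmf q m" if "j \<le> m" for j
    using that
  proof (induction j)
    case (Suc j)
    have "b * pmf q (m - Suc j) \<le> pmf q (Suc (m - Suc j))"
      using Suc.prems by (intro step) auto
    also have "Suc (m - Suc j) = m - j"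
      using Suc.prems by simp
    finally have "b ^ j * (b * pmf q (m - Suc j)) \<le> b ^ j * pmf q (m - j)"
      using b by (intro mult_left_mono) auto
    also have "\<dots> \<le> pmf q m"
      using Suc by simp
    finally show ?case
      by (simp add: mult_ac)
  qed simp
  have "(\<Sum>k\<le>m. pmf q k) = 1"
    using supp by (intro sum_pmf_eq_1) auto
  then have "b ^ m = (\<Sum>k\<le>m. b ^ m * pmf q k)"
    by (simp add: sum_distrib_left[symmetric])
  also have "\<dots> \<le> (\<Sum>k\<le>m. b ^ k * pmf q m)"
  proof (rule sum_mono)
    fix k assume "k \<in> {..m}"
    then have k: "k \<le> m"
      by simp
    have "b ^ m * pmf q k = b ^ k * (b ^ (m - k) * pmf q (m - (m - k)))"
      using k by (simp add: power_add[symmetric] mult.assoc[symmetric])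
    also have "\<dots> \<le> b ^ k * pmf q m"
      using b down[of "m - k"] by (intro mult_left_mono) auto
    finally show "b ^ m * pmf q k \<le> b ^ k * pmf q m" .
  qed
  also have "\<dots> = pmf q m * (\<Sum>k\<le>m. b ^ k)"
    by (simp add: sum_distrib_left mult.commute)
  finally have "(1 - b) * b ^ m \<le> (1 - b) * (pmf q m * (\<Sum>k\<le>m. b ^ k))"
    using b by (intro mult_left_mono) auto
  also have "\<dots> = pmf q m * (1 - b ^ Suc m)"
    using sum_gp_basic[of b m] by (metis mult.left_commute)
  also have "\<dots> \<le> pmf q m * 1"
    using b by (intro mult_left_mono) auto
  finally show ?thesis
    by simp
qed

lemma pmf_nat_not_incseq:
  fixes q :: "nat pmf"
  shows "\<not> incseq (pmf q)"
proof
  assume inc: "incseq (pmf q)"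
  have "summable (pmf q)"
    using pmf_abs_summable[of q UNIV] by (simp add: abs_summable_on_nat_iff')
  then have "pmf q \<longlonglongrightarrow> 0"
    by (rule summable_LIMSEQ_zero)
  then have "pmf q k \<le> 0" for k
    using inc by (rule incseq_le[rotated])
  then have "pmf q k = 0" for k
    by (simp add: order.antisym)
  then have "set_pmf q = {}"
    by (auto simp: set_pmf_eq)
  then show False
    by (simp add: set_pmf_not_empty)
qed

text \<open>
  Capping each queue at \<open>i\<close> ensures that the total is maximal exactly when every queue has reached
  \<open>i\<close>.  An uncapped total could be large because of one long queue fed by other dispatchers.
\<close>

definition capped_total :: "'s set \<Rightarrow> nat \<Rightarrow> ('s \<Rightarrow> nat) \<Rightarrow> nat" where
  "capped_total N i x = (\<Sum>u\<in>N. min (x u) i)"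

lemma capped_total_le: "capped_total N i x \<le> card N * i"
  unfolding capped_total_def by (rule sum_bounded_above[where K = i, simplified]) simp

lemma capped_total_eq_max_iff:
  assumes "finite N"
  shows "capped_total N i x = card N * i \<longleftrightarrow> (\<forall>v\<in>N. i \<le> x v)"
proof
  show "capped_total N i x = card N * i" if "\<forall>v\<in>N. i \<le> x v"
    using that by (simp add: capped_total_def min_absorb2)
next
  assume eq: "capped_total N i x = card N * i"
  show "\<forall>v\<in>N. i \<le> x v"
  proof (rule ccontr)
    assume "\<not> (\<forall>v\<in>N. i \<le> x v)"
    then have "capped_total N i x < (\<Sum>u\<in>N. i)"
      unfolding capped_total_def using assms
      by (intro sum_strict_mono_ex1) (auto simp: not_le min_less_iff_disj)
    then show False
      using eq by simp
  qed
qed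

lemma capped_total_update:
  assumes "finite N"
  shows "capped_total N i (x(u := y)) + (if u \<in> N then min (x u) i else 0) =
    capped_total N i x + (if u \<in> N then min y i else 0)"
proof (cases "u \<in> N")
  case True
  have "(\<Sum>w\<in>N - {u}. min ((x(u := y)) w) i) = (\<Sum>w\<in>N - {u}. min (x w) i)"
    by (rule sum.cong) auto
  then show ?thesis
    using True assms by (simp add: capped_total_def sum.remove[of N u])
next
  case False
  have "(\<Sum>w\<in>N. min ((x(u := y)) w) i) = (\<Sum>w\<in>N. min (x w) i)"
    using False by (intro sum.cong) auto
  then show ?thesis
    using False by (simp add: capped_total_def)
qed

lemma capped_total_eq_total_iff:
  assumes "finite N" and "m < i"
  shows "capped_total N i x = m \<longleftrightarrow> (\<Sum>u\<in>N. x u) = m"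
proof (cases "\<exists>u\<in>N. i < x u")
  case True
  then obtain u where u: "u \<in> N" "i < x u"
    by blast
  have "min (x u) i \<le> capped_total N i x"
    unfolding capped_total_def by (rule member_le_sum) (use assms u in auto)
  moreover have "x u \<le> (\<Sum>u\<in>N. x u)"
    by (rule member_le_sum) (use assms u in auto)
  ultimately show ?thesis
    using u assms by auto
next
  case False
  then have "capped_total N i x = (\<Sum>u\<in>N. x u)"
    unfolding capped_total_def by (intro sum.cong) auto
  then show ?thesis
    by simp
qed

text \<open>
  Flux balance for the event that the capped total exceeds \<open>k\<close>.  As long as the total is below
  its maximum, some queue of the dispatcher is below the cap, hence so are all its shortest queues,
  and every task of \<open>d\<close> raises the total; other dispatchers can only help.  Departures
  lower it at a rate of at most \<open>mu0\<close> per server.  So the capped total behaves at least like a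
  birth-death chain with birth rate \<open>lam0\<close> and death rate \<open>card (servers_of E d) * mu0\<close>, without any
  coupling of processes.
\<close>

lemma capped_total_birth_death:
  fixes E :: "('d::finite \<times> 's::finite) set"
  assumes ne: "servers_of E d \<noteq> {}"
    and lam: "\<And>d. 0 \<le> lam d" "lam0 \<le> lam d" and mu: "\<And>u. 0 \<le> mu u" "\<And>u. mu u \<le> mu0"
    and proc: "load_balancing_process E lam mu Pr X"
    and stat: "stationary_distribution Pr X p"
    and k: "k < card (servers_of E d) * i"
  shows "lam0 * pmf (map_pmf (capped_total (servers_of E d) i) p) k \<le>
    real (card (servers_of E d)) * mu0 * pmf (map_pmf (capped_total (servers_of E d) i) p) (Suc k)"
proof -
  let ?N = "servers_of E d"
  let ?T = "capped_total ?N i"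
  let ?A = "{x. Suc k \<le> ?T x}"
  let ?up = "\<lambda>x. \<Sum>u\<in>UNIV. arrival_rate E lam x u * (indicator ?A (x(u := x u + 1)) - indicator ?A x)"
  let ?dn = "\<lambda>x. \<Sum>u\<in>UNIV. departure_rate mu x u * (indicator ?A (x(u := x u - 1)) - indicator ?A x)"
  let ?I = "\<lambda>m x. indicator {x. ?T x = m} x :: real"
  have fin: "finite ?N"
    by simp
  have arr0: "0 \<le> arrival_rate E lam x u" for x u
    by (rule arrival_rate_nonneg) (rule lam)
  have up_pos: "(if ?T x = k \<and> u \<in> ?N \<and> x u < i then 1 else 0) \<le>
      (indicator ?A (x(u := x u + 1)) - indicator ?A x :: real)" for x u
    using capped_total_update[OF fin, of i x u "x u + 1"] by (auto simp: indicator_def min_def split: if_splits)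
  have up: "lam0 * ?I k x \<le> ?up x" for x
  proof (cases "?T x = k")
    case True
    have "\<exists>v\<in>?N. x v < i"
      using capped_total_eq_max_iff[OF fin, of i x] True k by (auto simp: not_le)
    then obtain v where v: "v \<in> ?N" "x v < i"
      by blast
    have "Min (x ` ?N) \<le> x v"
      using v by simp
    then have "Min (x ` ?N) < i"
      using v(2) by (rule le_less_trans)
    then have sq: "shortest_queues E x d \<subseteq> {u. u \<in> ?N \<and> x u < i}"
      unfolding shortest_queues_def by clarsimp
    have "lam0 * ?I k x \<le> (\<Sum>d\<in>{d}. lam d)"
      using lam True by simp
    also have "\<dots> \<le> (\<Sum>u\<in>{u. u \<in> ?N \<and> x u < i}. arrival_rate E lam x u)"
      by (rule sum_arrival_rate_ge) (use lam ne sq in auto)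
    also have "\<dots> = (\<Sum>u\<in>UNIV. arrival_rate E lam x u * (if ?T x = k \<and> u \<in> ?N \<and> x u < i then 1 else 0))"
      using True by (simp add: sum.If_cases if_distrib[of "(*) _"] cong: if_cong)
    also have "\<dots> \<le> ?up x"
      by (intro sum_mono mult_left_mono up_pos arr0)
    finally show ?thesis .
  next
    case False
    have "0 \<le> (indicator ?A (x(u := x u + 1)) - indicator ?A x :: real)" for u
      using up_pos[of x u] False by simp
    then have "0 \<le> ?up x"
      by (intro sum_nonneg mult_nonneg_nonneg arr0)
    then show ?thesis
      using False by simp
  qed
  have dn_pos: "- (if u \<in> ?N then ?I (Suc k) x else 0) \<le>
      (indicator ?A (x(u := x u - 1)) - indicator ?A x :: real)" for x u
    using capped_total_update[OF fin, of i x u "x u - 1"] by (auto simp: indicator_def min_def split: if_splits)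
  have dn: "- (real (card ?N) * mu0 * ?I (Suc k) x) \<le> ?dn x" for x
  proof -
    have "- (real (card ?N) * mu0 * ?I (Suc k) x) = (\<Sum>u\<in>UNIV. - (mu0 * (if u \<in> ?N then ?I (Suc k) x else 0)))"
      by (simp add: sum_negf if_distrib[of "(*) _"] sum.If_cases cong: if_cong)
    also have "\<dots> \<le> ?dn x"
    proof (rule sum_mono)
      fix u
      let ?J = "if u \<in> ?N then ?I (Suc k) x else 0"
      have "departure_rate mu x u * ?J \<le> mu0 * ?J"
        using departure_rate_bounds(2)[of mu x u] mu by (intro mult_right_mono) (auto intro: order.trans)
      then have "- (mu0 * ?J) \<le> departure_rate mu x u * - ?J"
        by simp
      also have "\<dots> \<le> departure_rate mu x u * (indicator ?A (x(u := x u - 1)) - indicator ?A x)"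
        by (intro mult_left_mono dn_pos) (auto simp: departure_rate_def mu)
      finally show "- (mu0 * ?J) \<le> departure_rate mu x u * (indicator ?A (x(u := x u - 1)) - indicator ?A x)" .
    qed
    finally show ?thesis .
  qed
  have bnd: "\<bar>a * (indicator B x - indicator C y)\<bar> \<le> L" if "\<bar>a\<bar> \<le> L" for a L :: real and B C :: "('s \<Rightarrow> nat) set" and x y
    using that by (auto simp: indicator_def)
  have int: "integrable (measure_pmf p) (\<lambda>x. ?up x + ?dn x)"
  proof (intro Bochner_Integration.integrable_add Bochner_Integration.integrable_sum)
    fix u
    show "integrable (measure_pmf p)
        (\<lambda>x. arrival_rate E lam x u * (indicator ?A (x(u := x u + 1)) - indicator ?A x))"
      using arr0 arrival_rate_le[of lam E _ u, OF lam(1)]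
      by (intro integrable_pmf_bounded[OF bnd[where L = "\<Sum>d\<in>UNIV. lam d"]]) simp
    show "integrable (measure_pmf p)
        (\<lambda>x. departure_rate mu x u * (indicator ?A (x(u := x u - 1)) - indicator ?A x))"
      using departure_rate_bounds[of mu _ u, OF mu(1)]
      by (intro integrable_pmf_bounded[OF bnd[where L = "mu u"]]) simp
  qed
  have indI: "integrable (measure_pmf p) (?I m)" for m
    by (rule integrable_pmf_bounded[of _ 1]) (auto simp: indicator_def)
  have "(\<integral>x. lam0 * ?I k x - real (card ?N) * mu0 * ?I (Suc k) x \<partial>measure_pmf p) \<le>
      (\<integral>x. ?up x + ?dn x \<partial>measure_pmf p)"
  proof (rule integral_mono[OF _ int])
    show "lam0 * ?I k x - real (card ?N) * mu0 * ?I (Suc k) x \<le> ?up x + ?dn x" for x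
      using up[of x] dn[of x] by linarith
  qed (intro Bochner_Integration.integrable_diff integrable_mult_right indI)
  also have "\<dots> = 0"
    by (rule load_balancing_flux_balance[OF lam(1) mu(1) proc stat])
  finally have "lam0 * (\<integral>x. ?I k x \<partial>measure_pmf p) \<le>
      real (card ?N) * mu0 * (\<integral>x. ?I (Suc k) x \<partial>measure_pmf p)"
    by (subst (asm) Bochner_Integration.integral_diff) (auto intro!: integrable_mult_right indI)
  then show ?thesis
    by (simp add: pmf_map vimage_def)
qed

text \<open>
  This stability condition follows already from the existence of a stationary distribution:
  otherwise the total number of tasks at the servers of \<open>d\<close> would have a nondecreasing probability
  mass function on \<open>nat\<close>.
\<close>

lemma dispatcher_load_less_degree:
  fixes E :: "('d::finite \<times> 's::finite) set"
  assumes ne: "servers_of E d \<noteq> {}"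
    and lam: "\<And>d. 0 \<le> lam d" "lam0 \<le> lam d"
    and mu: "\<And>u. 0 \<le> mu u" "\<And>u. mu u \<le> mu0" "0 < mu0"
    and proc: "load_balancing_process E lam mu Pr X"
    and stat: "stationary_distribution Pr X p"
  shows "lam0 < real (card (servers_of E d)) * mu0"
proof (rule ccontr)
  let ?N = "servers_of E d"
  let ?q = "map_pmf (\<lambda>x. \<Sum>u\<in>?N. x u) p"
  assume "\<not> lam0 < real (card ?N) * mu0"
  then have ge: "real (card ?N) * mu0 \<le> lam0"
    by simp
  have card: "0 < card ?N"
    using ne by (simp add: card_gt_0_iff)
  have "incseq (pmf ?q)"
  proof (rule incseq_SucI)
    fix k
    (* The cap is chosen above k + 1, so that it is invisible at the levels k and k + 1. *)
    let ?i = "Suc (Suc k)"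
    have q: "pmf (map_pmf (capped_total ?N ?i) p) m = pmf ?q m" if "m < ?i" for m
      using capped_total_eq_total_iff[OF _ that, of ?N] by (simp add: pmf_map vimage_def)
    have "1 * ?i \<le> card ?N * ?i"
      using card by (intro mult_right_mono) auto
    then have "k < card ?N * ?i"
      by simp
    then have "lam0 * pmf ?q k \<le> real (card ?N) * mu0 * pmf ?q (Suc k)"
      using capped_total_birth_death[OF ne lam mu(1,2) proc stat, of k ?i] q[of k] q[of "Suc k"] by simp
    moreover have "real (card ?N) * mu0 * pmf ?q k \<le> lam0 * pmf ?q k"
      using ge by (intro mult_right_mono) auto
    ultimately have "real (card ?N) * mu0 * pmf ?q k \<le> real (card ?N) * mu0 * pmf ?q (Suc k)"
      by linarith
    then show "pmf ?q k \<le> pmf ?q (Suc k)"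
      using card mu(3) by (simp add: mult_le_cancel_left_pos)
  qed
  then show False
    using pmf_nat_not_incseq by blast
qed

text \<open>
  The ratio of birth and death rates is \<open>lam0 / mu0 / n\<close>, where \<open>n\<close> is the degree of \<open>d\<close>.  It is
  lowered to \<open>lam0 / mu0 / (n + 1)\<close> so that, by \<open>dispatcher_load_less_degree\<close>, the factor \<open>1 - b\<close> is
  at least \<open>1 / (n + 1)\<close>.
\<close>

lemma all_servers_filled_ge:
  fixes E :: "('d::finite \<times> 's::finite) set" and lam0 mu0 b :: real and d :: 'd
  defines "b \<equiv> lam0 / mu0 / (real (card (servers_of E d)) + 1)"
  assumes ne: "servers_of E d \<noteq> {}"
    and lam: "\<And>d. 0 \<le> lam d" "lam0 \<le> lam d" "0 < lam0"
    and mu: "\<And>u. 0 \<le> mu u" "\<And>u. mu u \<le> mu0" "0 < mu0"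
    and proc: "load_balancing_process E lam mu Pr X"
    and stat: "stationary_distribution Pr X p"
  shows "(1 - b) * b ^ (card (servers_of E d) * i) \<le>
    measure (measure_pmf p) {x. \<forall>v\<in>servers_of E d. i \<le> x v}"
proof -
  let ?N = "servers_of E d"
  let ?n = "real (card ?N)"
  let ?q = "map_pmf (capped_total ?N i) p"
  have less: "lam0 < ?n * mu0"
    using dispatcher_load_less_degree[OF ne lam(1,2) mu proc stat] .
  have b: "0 < b" "b < 1"
    using lam(3) mu(3) less by (auto simp: b_def field_simps)
  have "(1 - b) * b ^ (card ?N * i) \<le> pmf ?q (card ?N * i)"
  proof (rule pmf_geometric_lower_bound[OF _ b])
    show "set_pmf ?q \<subseteq> {..card ?N * i}"
      by (auto simp: capped_total_le)
    fix k assume k: "k < card ?N * i"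
    then have "0 < ?n * mu0"
      using mu(3) by (intro mult_pos_pos) (auto intro: ccontr)
    moreover have "b * (?n * mu0) \<le> lam0"
    proof -
      have "b * (?n * mu0) \<le> b * ((?n + 1) * mu0)"
        using b mu(3) by (intro mult_left_mono) auto
      also have "\<dots> = lam0"
        using mu(3) by (simp add: b_def add_nonneg_eq_0_iff)
      finally show ?thesis .
    qed
    then have "b * (?n * mu0) * pmf ?q k \<le> lam0 * pmf ?q k"
      by (intro mult_right_mono) auto
    moreover have "lam0 * pmf ?q k \<le> ?n * mu0 * pmf ?q (Suc k)"
      using capped_total_birth_death[OF ne lam(1,2) mu(1,2) proc stat k] .
    ultimately have "(?n * mu0) * (b * pmf ?q k) \<le> (?n * mu0) * pmf ?q (Suc k)"
      by (simp add: mult_ac)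
    then show "b * pmf ?q k \<le> pmf ?q (Suc k)"
      using \<open>0 < ?n * mu0\<close> by (simp only: mult_le_cancel_left_pos)
  qed
  also have "\<dots> = measure (measure_pmf p) {x. \<forall>v\<in>?N. i \<le> x v}"
    by (simp add: pmf_map vimage_def capped_total_eq_max_iff)
  finally show ?thesis .
qed

section \<open>Averaging over the dispatchers\<close>

lemma convex_on_eq_on:
  assumes "convex_on C f" and "\<And>x. x \<in> C \<Longrightarrow> f x = g x"
  shows "convex_on C g"
proof (rule convex_onI)
  show C: "convex C"
    using assms(1) by (simp add: convex_on_def)
  fix t :: real and x y
  assume t: "0 < t" "t < 1" and xy: "x \<in> C" "y \<in> C"
  have "(1 - t) *\<^sub>R x + t *\<^sub>R y \<in> C"
    using C t xy by (intro convexD) auto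
  then show "g ((1 - t) *\<^sub>R x + t *\<^sub>R y) \<le> (1 - t) * g x + t * g y"
    using convex_onD[OF assms(1), of t x y] t xy by (simp add: assms(2)[symmetric])
qed

text \<open>
  Written as \<open>exp \<circ> h\<close>, the function has second derivative \<open>exp \<circ> h\<close> times \<open>h'\<^sup>2 + h''\<close>.  The only
  negative contribution to \<open>h''\<close> is \<open>- i / y\<close>.  For \<open>y > \<rho>\<close> it is absorbed by \<open>h'\<^sup>2\<close>, because then
  \<open>\<bar>h' y\<bar> \<ge> i + 1 / y\<close> and the square contains the cross term \<open>2 i / y\<close>.
\<close>

lemma convex_on_r_power_divide:
  fixes \<rho> :: real
  assumes \<rho>: "0 < \<rho>"
  shows "convex_on {\<rho><..} (\<lambda>y. r \<rho> y ^ i / y)"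
proof -
  define g where "g y = exp (real i * y * (ln \<rho> - ln y) - ln y)" for y
  define h' where "h' y = real i * (ln \<rho> - ln y - 1) - 1 / y" for y
  have "convex_on {\<rho><..} g"
  proof (rule f''_ge0_imp_convex[where f' = "\<lambda>y. g y * h' y"
        and f'' = "\<lambda>y. g y * ((h' y)\<^sup>2 + (1 / y\<^sup>2 - real i / y))"])
    fix y assume "y \<in> {\<rho><..}"
    then have y: "\<rho> < y" "0 < y"
      using \<rho> by auto
    show g': "(g has_real_derivative g y * h' y) (at y)"
      unfolding g_def h'_def using y
      by (auto intro!: derivative_eq_intros simp: field_simps)
    have "(h' has_real_derivative 1 / y\<^sup>2 - real i / y) (at y)"
      unfolding h'_def using y
      by (auto intro!: derivative_eq_intros simp: field_simps power2_eq_square)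
    from DERIV_mult[OF g' this]
    show "((\<lambda>y. g y * h' y) has_real_derivative g y * ((h' y)\<^sup>2 + (1 / y\<^sup>2 - real i / y))) (at y)"
      by (simp add: power2_eq_square algebra_simps)
    have "ln \<rho> < ln y"
      using y \<rho> by simp
    then have "real i * 1 + 1 / y \<le> real i * (1 - (ln \<rho> - ln y)) + 1 / y"
      by (intro add_right_mono mult_left_mono) auto
    also have "\<dots> = - h' y"
      by (simp add: h'_def algebra_simps)
    finally have "(real i + 1 / y)\<^sup>2 \<le> (- h' y)\<^sup>2"
      using y by (intro power_mono) auto
    moreover have "real i / y \<le> (real i + 1 / y)\<^sup>2"
    proof -
      have "(real i + 1 / y)\<^sup>2 = (real i)\<^sup>2 + (1 / y)\<^sup>2 + 2 * (real i / y)"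
        by (simp add: power2_sum)
      moreover have "0 \<le> real i / y"
        using y by simp
      ultimately show ?thesis
        using zero_le_power2[of "real i"] zero_le_power2[of "1 / y"] by linarith
    qed
    moreover have "0 \<le> 1 / y\<^sup>2"
      by simp
    ultimately have "0 \<le> (h' y)\<^sup>2 + (1 / y\<^sup>2 - real i / y)"
      unfolding power2_minus by linarith
    then show "0 \<le> g y * ((h' y)\<^sup>2 + (1 / y\<^sup>2 - real i / y))"
      by (simp add: g_def)
  qed simp
  moreover have "g y = r \<rho> y ^ i / y" if "y \<in> {\<rho><..}" for y
  proof -
    have y: "0 < y"
      using that \<rho> by simp
    have "r \<rho> y ^ i = exp (real i * (y * (ln \<rho> - ln y)))"
      using \<rho> y by (simp add: r_def powr_def ln_div exp_of_nat_mult)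
    then show ?thesis
      using y by (simp add: g_def exp_diff mult.assoc)
  qed
  ultimately show ?thesis
    by (rule convex_on_eq_on)
qed

lemma mean_r_power_divide_ge:
  fixes f :: "'d::finite \<Rightarrow> real"
  assumes "0 < \<rho>" and "\<And>d. \<rho> < f d"
  shows "real CARD('d) * (r \<rho> ((\<Sum>d\<in>UNIV. f d) / real CARD('d)) ^ i / ((\<Sum>d\<in>UNIV. f d) / real CARD('d)))
    \<le> (\<Sum>d\<in>UNIV. r \<rho> (f d) ^ i / f d)"
proof -
  let ?n = "real CARD('d)"
  let ?g = "\<lambda>y. r \<rho> y ^ i / y"
  have "?g (\<Sum>d\<in>UNIV. (1 / ?n) *\<^sub>R f d) \<le> (\<Sum>d\<in>UNIV. 1 / ?n * ?g (f d))"
    by (rule convex_on_sum[OF _ _ convex_on_r_power_divide[OF assms(1)]]) (use assms(2) in auto)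
  moreover have "(\<Sum>d\<in>UNIV. (1 / ?n) *\<^sub>R f d) = (\<Sum>d\<in>UNIV. f d) / ?n"
    by (simp add: sum_divide_distrib)
  moreover have "(\<Sum>d\<in>UNIV. 1 / ?n * ?g (f d)) = (\<Sum>d\<in>UNIV. ?g (f d)) / ?n"
    by (simp add: sum_divide_distrib mult.commute)
  ultimately have "?g ((\<Sum>d\<in>UNIV. f d) / ?n) \<le> (\<Sum>d\<in>UNIV. ?g (f d)) / ?n"
    by simp
  then show ?thesis
    by (simp add: pos_le_divide_eq mult.commute)
qed

lemma card_servers_le:
  fixes E :: "('d::finite \<times> 's::finite) set"
  assumes "no_isolated_nodes E"
  shows "real CARD('s) \<le> mean_degree E * real CARD('d)"
proof -
  have "(UNIV :: 's set) = (\<Union>d. servers_of E d)"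
    using assms by (auto simp: no_isolated_nodes_def dispatchers_of_def servers_of_def)
  then have "CARD('s) \<le> (\<Sum>d\<in>UNIV. card (servers_of E d))"
    using card_UN_le[of "UNIV :: 'd set" "servers_of E"] by simp
  then have "real CARD('s) \<le> (\<Sum>d\<in>UNIV. real (card (servers_of E d)))"
    by (metis of_nat_le_iff of_nat_sum)
  then show ?thesis
    by (simp add: mean_degree_def)
qed

lemma expectation_occupancy:
  fixes p :: "('s::finite \<Rightarrow> nat) pmf"
  shows "(\<integral>x. occupancy x i \<partial>measure_pmf p) = 
    (\<Sum>u\<in>UNIV. measure (measure_pmf p) {x. i \<le> x u}) / real CARD('s)"
proof -
  have int: "integrable (measure_pmf p) (indicator B :: ('s \<Rightarrow> nat) \<Rightarrow> real)" for B
    by (rule integrable_pmf_bounded[of _ 1]) (auto simp: indicator_def)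
  have "occupancy x i = (\<Sum>u\<in>UNIV. indicator {x. i \<le> x u} x) / real CARD('s)" for x :: "'s \<Rightarrow> nat"
    unfolding occupancy_def by (intro arg_cong2[where f = "(/)"] sum.cong) (auto simp: indicator_def)
  then have "(\<integral>x. occupancy x i \<partial>measure_pmf p) = 
      (\<integral>x. (\<Sum>u\<in>UNIV. indicator {x. i \<le> x u} x) \<partial>measure_pmf p) / real CARD('s)"
    by (simp only: integral_divide_zero)
  also have "(\<integral>x. (\<Sum>u\<in>UNIV. indicator {x. i \<le> x u} x :: real) \<partial>measure_pmf p) =
      (\<Sum>u\<in>UNIV. \<integral>x. indicator {x. i \<le> x u} x \<partial>measure_pmf p)"
    by (intro Bochner_Integration.integral_sum int)
  finally show ?thesis
    by simp
qed

text \<open>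
  With \<open>\<rho> = lam0 / mu0\<close> and \<open>n\<close> the degree of \<open>d\<close>, each dispatcher contributes at least
  \<open>r \<rho> (n + 1) ^ i / (n + 1)\<close> to the flux of \<open>sum_server_tails_ge\<close>, and by Jensen's inequality the
  average of these terms is at least the value at the mean degree.  The factor \<open>1 / mean_degree E\<close>
  is a lower bound for the number of dispatchers per server.
\<close>

lemma stationary_occupancy_ge:
  fixes E :: "('d::finite \<times> 's::finite) set"
  assumes E: "no_isolated_nodes E"
    and lam: "\<And>d. lam0 \<le> lam d" "0 < lam0"
    and mu: "\<And>u. 0 \<le> mu u" "\<And>u. mu u \<le> mu0" "0 < mu0"
    and proc: "load_balancing_process E lam mu Pr X"
    and stat: "stationary_distribution Pr X p"
    and i: "0 < i"
  shows "lam0 / mu0 / mean_degree E * (r (lam0 / mu0) (mean_degree E + 1) ^ i / (mean_degree E + 1)) \<le>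
    (\<integral>x. occupancy x i \<partial>measure_pmf p)"
proof -
  define \<rho> where "\<rho> = lam0 / mu0"
  define n where "n d = real (card (servers_of E d))" for d
  define \<beta> where "\<beta> = mean_degree E"
  let ?g = "\<lambda>y. r \<rho> y ^ i / y"
  let ?D = "real CARD('d)" and ?S = "real CARD('s)"
  (* Level i - 1 suffices, since sum_server_tails_ge raises the level by one. *)
  let ?full = "\<lambda>d. measure (measure_pmf p) {x. \<forall>v\<in>servers_of E d. i - 1 \<le> x v}"
  have \<rho>: "0 < \<rho>"
    using lam(2) mu(3) by (simp add: \<rho>_def)
  have lam': "0 \<le> lam d" for d
    using lam(1)[of d] lam(2) by linarith
  have ne: "servers_of E d \<noteq> {}" for d
    using E by (simp add: no_isolated_nodes_def)
  have less: "\<rho> < n d" for d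
    using dispatcher_load_less_degree[OF ne lam' lam(1) mu proc stat, of d] mu(3)
    by (simp add: \<rho>_def n_def field_simps)
  have full: "?g (n d + 1) \<le> ?full d" for d
  proof -
    define b where "b = \<rho> / (n d + 1)"
    have n: "0 \<le> n d"
      by (simp add: n_def)
    have b: "0 < b" "b \<le> 1"
      using \<rho> less[of d] n by (auto simp: b_def field_simps)
    have "r \<rho> (n d + 1) = b ^ (card (servers_of E d) + 1)"
      using b(1) powr_realpow[of b "card (servers_of E d) + 1"] by (simp add: r_def b_def n_def add.commute)
    then have "r \<rho> (n d + 1) ^ i = b ^ ((card (servers_of E d) + 1) * i)"
      by (simp only: power_mult)
    also have "\<dots> \<le> b ^ (card (servers_of E d) * (i - 1))"
      using b by (intro power_decreasing mult_mono) auto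
    finally have "1 / (n d + 1) * r \<rho> (n d + 1) ^ i \<le> 1 / (n d + 1) * b ^ (card (servers_of E d) * (i - 1))"
      using n by (intro mult_left_mono) auto
    also have "1 / (n d + 1) \<le> 1 - b"
      using less[of d] n by (simp add: b_def field_simps)
    then have "1 / (n d + 1) * b ^ (card (servers_of E d) * (i - 1)) \<le> (1 - b) * b ^ (card (servers_of E d) * (i - 1))"
      using b by (intro mult_right_mono) auto
    also have "\<dots> \<le> ?full d"
      using all_servers_filled_ge[OF ne lam' lam(1,2) mu proc stat, of d "i - 1"]
      by (simp add: b_def \<rho>_def n_def)
    finally show ?thesis
      by simp
  qed
  have mean: "(\<Sum>d\<in>UNIV. n d + 1) / ?D = \<beta> + 1"
    by (simp add: \<beta>_def mean_degree_def n_def sum.distrib add_divide_distrib)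
  have "\<rho> < n d + 1" for d
    using less[of d] by simp
  then have "?D * ?g (\<beta> + 1) \<le> (\<Sum>d\<in>UNIV. ?g (n d + 1))"
    using mean_r_power_divide_ge[OF \<rho>, of "\<lambda>d. n d + 1" i] unfolding mean by blast
  also have "\<dots> \<le> (\<Sum>d\<in>UNIV. ?full d)"
    by (intro sum_mono full)
  finally have "lam0 * (?D * ?g (\<beta> + 1)) \<le> lam0 * (\<Sum>d\<in>UNIV. ?full d)"
    using lam(2) by (intro mult_left_mono) auto
  also have "\<dots> \<le> mu0 * (\<Sum>u\<in>UNIV. measure (measure_pmf p) {x. Suc (i - 1) \<le> x u})"
    using lam(2) by (intro sum_server_tails_ge[OF E lam(1) _ mu(1,2) proc stat]) simp
  also have "Suc (i - 1) = i"
    using i by simp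
  also have "mu0 * (\<Sum>u\<in>UNIV. measure (measure_pmf p) {x. i \<le> x u}) =
      mu0 * (?S * (\<integral>x. occupancy x i \<partial>measure_pmf p))"
    by (simp add: expectation_occupancy)
  finally have "lam0 * (?D * ?g (\<beta> + 1)) \<le> mu0 * (?S * (\<integral>x. occupancy x i \<partial>measure_pmf p))" .
  then have main: "\<rho> * (?D * ?g (\<beta> + 1)) \<le> ?S * (\<integral>x. occupancy x i \<partial>measure_pmf p)"
    unfolding \<rho>_def times_divide_eq_left
    by (subst pos_divide_le_eq[OF mu(3)]) (simp only: mult.commute[of _ mu0])
  have S: "?S \<le> \<beta> * ?D"
    unfolding \<beta>_def by (rule card_servers_le[OF E])
  have \<beta>: "0 < \<beta>"
    using order.strict_trans2[OF _ S, of 0] by (simp add: zero_less_mult_iff)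
  have nonneg: "0 \<le> (\<integral>x. occupancy x i \<partial>measure_pmf p)"
    unfolding expectation_occupancy by (intro divide_nonneg_nonneg sum_nonneg) auto
  have "?D * (\<rho> * ?g (\<beta> + 1)) \<le> \<beta> * ?D * (\<integral>x. occupancy x i \<partial>measure_pmf p)"
    using main mult_right_mono[OF S nonneg] by (simp add: mult_ac)
  then have "\<rho> * ?g (\<beta> + 1) \<le> \<beta> * (\<integral>x. occupancy x i \<partial>measure_pmf p)"
    using mult_le_cancel_left_pos[of ?D "\<rho> * ?g (\<beta> + 1)" "\<beta> * (\<integral>x. occupancy x i \<partial>measure_pmf p)"]
    by (simp add: mult_ac)
  then have "\<rho> * ?g (\<beta> + 1) / \<beta> \<le> (\<integral>x. occupancy x i \<partial>measure_pmf p)"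
    using \<beta> by (simp only: pos_divide_le_eq mult.commute)
  then show ?thesis
    by (simp add: \<rho>_def \<beta>_def mult_ac)
qed

theorem theorem2:
  fixes E :: "('d::finite \<times> 's::finite) set"
    and lam :: "'d \<Rightarrow> real" and mu :: "'s \<Rightarrow> real"
    and lam0 mu0 \<rho>0 \<beta> :: real
    and Pr :: "('s \<Rightarrow> nat) \<Rightarrow> 'w measure" and X :: "real \<Rightarrow> 'w \<Rightarrow> 's \<Rightarrow> nat"
    and Y :: "'v \<Rightarrow> 's \<Rightarrow> nat" and M :: "'v measure" and p :: "('s \<Rightarrow> nat) pmf"
    and i :: nat
  assumes "no_isolated_nodes E"
    and "\<And>d. 0 < lam d" and "\<And>u. 0 < mu u"
    and "load_balancing_process E lam mu Pr X"
    and "0 < lam0" and "lam0 \<le> Min (range lam)" and "Max (range mu) \<le> mu0"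
    and "\<rho>0 = lam0 / mu0"
    and "\<beta> = mean_degree E"
    and "ergodic Pr X"
    and "stationary_distribution Pr X p"
    and "prob_space M" and "Y \<in> measurable M (count_space UNIV)"
    and "distr M (count_space UNIV) Y = measure_pmf p"
    and "real i \<ge> 1 / \<rho>0"
  shows "(\<integral>\<omega>. occupancy (Y \<omega>) i \<partial>M) \<ge>
           \<rho>0 / (\<beta> * (\<beta> + 1) + \<rho>0) * (r \<rho>0 (\<beta> + 1) ^ i / (\<beta> + 1))"
proof -
  have lam: "lam0 \<le> lam d" for d
    using assms(6) Min_le[of "range lam" "lam d"] by simp
  have mu: "mu u \<le> mu0" for u
    using assms(7) Max_ge[of "range mu" "mu u"] by simp
  have mu0: "0 < mu0"
    using assms(3) mu less_le_trans by blast
  have \<rho>: "0 < \<rho>0"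
    using assms(5,8) mu0 by simp
  have i: "0 < i"
    using assms(15) \<rho> by (intro gr0I) (simp add: divide_le_0_iff)
  have "0 < \<beta> * real CARD('d)"
    using card_servers_le[OF assms(1)] unfolding assms(9)[symmetric]
    by (rule less_le_trans[rotated]) simp
  then have \<beta>: "0 < \<beta>"
    by (simp add: zero_less_mult_iff)
  have "\<beta> * 1 \<le> \<beta> * (\<beta> + 1)"
    using \<beta> by (intro mult_left_mono) auto
  then have "\<rho>0 / (\<beta> * (\<beta> + 1) + \<rho>0) \<le> \<rho>0 / \<beta>"
    using \<rho> \<beta> by (intro divide_left_mono mult_pos_pos add_pos_pos) linarith+
  then have "\<rho>0 / (\<beta> * (\<beta> + 1) + \<rho>0) * (r \<rho>0 (\<beta> + 1) ^ i / (\<beta> + 1)) \<le>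
      \<rho>0 / \<beta> * (r \<rho>0 (\<beta> + 1) ^ i / (\<beta> + 1))"
    using \<beta> by (intro mult_right_mono) (auto simp: r_def)
  also have "\<dots> \<le> (\<integral>x. occupancy x i \<partial>measure_pmf p)"
    unfolding assms(8,9)
    by (rule stationary_occupancy_ge[OF assms(1) lam assms(5) less_imp_le[OF assms(3)] mu mu0 assms(4,11) i])
  also have "\<dots> = (\<integral>\<omega>. occupancy (Y \<omega>) i \<partial>M)"
    unfolding assms(14)[symmetric] by (rule integral_distr[OF assms(13)]) simp
  finally show ?thesis .
qed

end
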